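(* Let $(X,T,\alpha)$ be a mixing topological Markov shift with countable state space $S$ and transition matrix $A=(A_{s,t})_{s,t\in S}$, and let $\pi:S\to\mathbb R^+=(0,\infty)$. There is a measure $\mu\in\mathfrak M_\alpha(X)$ such that $\frac{d\mu\circ T}{d\mu}$ is $\alpha$-measurable and $\mu([s])=\pi_s$ for all $s\in S$ if and only if $\Pi(s):=\sum_{t\in S}A_{s,t}\pi_t<\infty$ for all $s\in S$. In this case, the measure $\mu$ is a Markov measure, and is unique.
   Context: A topological Markov shift with countable state space $S$ and $\{0,1\}$-transition matrix $A$ is $X=\{x\in S^{\mathbb N}: A_{x_i,x_{i+1}}=1\ \forall i\ge1\}$ with the left shift $T$, the partition $\alpha=\{[s]:s\in S\}$, $[s]=\{x\in X:x_1=s\}$ (nonempty), and the topology generated by the cylinders $[s_1,\dots,s_n]=\{x\in X: x_i=s_i,\ 1\le i\le n\}$. It is mixing if for all $a,b\in\alpha$, $a\cap T^{-n}b\ne\emptyset$ for all sufficiently large $n$. $\mathfrak M_\alpha(X)$ is the set of ($\sigma$-finite Borel) measures $\mu$ on $X$ with $\mu(a)<\infty$ for all $a\in\alpha$. The derivative $\frac{d\mu\circ T}{d\mu}$ is the Radon–Nikodym derivative of $B\mapsto\mu(TB)$ with respect to $\mu$ on each $a\in\alpha$ (where $T|_a$ is injective), it being understood that this is absolutely continuous. A function is $\alpha$-measurable if it is constant (a.e.) on each $a\in\alpha$. $\mu$ is a Markov measure if there is a stochastic matrix $(p_{s,t})_{s,t\in S}$ such that $\mu([s_1,\dots,s_n])=\mu([s_1])p_{s_1,s_2}\cdots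 p_{s_{n-1},s_n}$ for all cylinders. *)

theory Defs
  imports "HOL-Probability.Probability"
begin

text \<open>Sequences are indexed from \<open>0\<close>, so \<open>x i\<close> is the \<open>(i + 1)\<close>-st coordinate of \<open>x\<close>.\<close>

definition tms :: "'a set \<Rightarrow> ('a \<Rightarrow> 'a \<Rightarrow> real) \<Rightarrow> (nat \<Rightarrow> 'a) set" where
  "tms S A = {x. (\<forall>i. x i \<in> S) \<and> (\<forall>i. A (x i) (x (Suc i)) = 1)}"

definition shift :: "(nat \<Rightarrow> 'a) \<Rightarrow> nat \<Rightarrow> 'a" where
  "shift x = (\<lambda>i. x (Suc i))"

definition cylinder :: "'a set \<Rightarrow> ('a \<Rightarrow> 'a \<Rightarrow> real) \<Rightarrow> 'a list \<Rightarrow> (nat \<Rightarrow> 'a) set" where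
  "cylinder S A w = {x \<in> tms S A. \<forall>i<length w. x i = w ! i}"

definition alpha :: "'a set \<Rightarrow> ('a \<Rightarrow> 'a \<Rightarrow> real) \<Rightarrow> (nat \<Rightarrow> 'a) set set" where
  "alpha S A = (\<lambda>s. cylinder S A [s]) ` S"

definition tms_topology :: "'a set \<Rightarrow> ('a \<Rightarrow> 'a \<Rightarrow> real) \<Rightarrow> (nat \<Rightarrow> 'a) topology" where
  "tms_topology S A = topology_generated_by {cylinder S A w |w. w \<noteq> [] \<and> set w \<subseteq> S}"

definition is_tms :: "'a set \<Rightarrow> ('a \<Rightarrow> 'a \<Rightarrow> real) \<Rightarrow> bool" where
  "is_tms S A \<longleftrightarrow> countable S \<and> (\<forall>s\<in>S. \<forall>t\<in>S. A s t \<in> {0, 1}) \<and> (\<forall>a\<in>alpha S A. a \<noteq> {})"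

definition mixing_tms :: "'a set \<Rightarrow> ('a \<Rightarrow> 'a \<Rightarrow> real) \<Rightarrow> bool" where
  "mixing_tms S A \<longleftrightarrow> is_tms S A \<and>
     (\<forall>a\<in>alpha S A. \<forall>b\<in>alpha S A.
        eventually (\<lambda>n. a \<inter> (shift ^^ n) -` b \<noteq> {}) sequentially)"

definition M_alpha :: "'a set \<Rightarrow> ('a \<Rightarrow> 'a \<Rightarrow> real) \<Rightarrow> (nat \<Rightarrow> 'a) measure set" where
  "M_alpha S A = {\<mu>. space \<mu> = tms S A
      \<and> sets \<mu> = sigma_sets (tms S A) {U. openin (tms_topology S A) U}
      \<and> sigma_finite_measure \<mu>
      \<and> (\<forall>a\<in>alpha S A. emeasure \<mu> a < \<infinity>)}"

text \<open>The measure \<open>B \<mapsto> \<mu> (T B)\<close> on the measurable subsets \<open>B\<close> of \<open>a\<close>. On a cell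
  \<open>a \<in> alpha S A\<close> the shift is injective with measurable images of measurable sets, so
  this is countably additive and the value given to \<^const>\<open>measure_of\<close> is not discarded.\<close>

definition shift_pullback ::
    "(nat \<Rightarrow> 'a) measure \<Rightarrow> (nat \<Rightarrow> 'a) set \<Rightarrow> (nat \<Rightarrow> 'a) measure" where
  "shift_pullback \<mu> a =
     measure_of (space (restrict_space \<mu> a)) (sets (restrict_space \<mu> a))
       (\<lambda>B. emeasure \<mu> (shift ` B))"

definition shift_abs_continuous ::
    "'a set \<Rightarrow> ('a \<Rightarrow> 'a \<Rightarrow> real) \<Rightarrow> (nat \<Rightarrow> 'a) measure \<Rightarrow> bool" where
  "shift_abs_continuous S A \<mu> \<longleftrightarrow>
     (\<forall>a\<in>alpha S A. absolutely_continuous (restrict_space \<mu> a) (shift_pullback \<mu> a))"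

text \<open>The derivative of \<open>\<mu> \<circ> T\<close> with respect to \<open>\<mu>\<close>, glued from the cells: the cell
  containing \<open>x\<close> is \<open>cylinder S A [x 0]\<close>. Meaningful only under
  \<^const>\<open>shift_abs_continuous\<close>.\<close>

definition shift_deriv ::
    "'a set \<Rightarrow> ('a \<Rightarrow> 'a \<Rightarrow> real) \<Rightarrow> (nat \<Rightarrow> 'a) measure \<Rightarrow> (nat \<Rightarrow> 'a) \<Rightarrow> ennreal" where
  "shift_deriv S A \<mu> x =
     RN_deriv (restrict_space \<mu> (cylinder S A [x 0])) (shift_pullback \<mu> (cylinder S A [x 0])) x"

definition alpha_measurable ::
    "'a set \<Rightarrow> ('a \<Rightarrow> 'a \<Rightarrow> real) \<Rightarrow> (nat \<Rightarrow> 'a) measure \<Rightarrow> ((nat \<Rightarrow> 'a) \<Rightarrow> 'b) \<Rightarrow> bool" where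
  "alpha_measurable S A \<mu> f \<longleftrightarrow>
     (\<forall>a\<in>alpha S A. \<exists>c. AE x in \<mu>. x \<in> a \<longrightarrow> f x = c)"

definition stochastic_matrix :: "'a set \<Rightarrow> ('a \<Rightarrow> 'a \<Rightarrow> real) \<Rightarrow> bool" where
  "stochastic_matrix S p \<longleftrightarrow>
     (\<forall>s\<in>S. (\<forall>t\<in>S. p s t \<ge> 0) \<and> (p s has_sum 1) S)"

text \<open>The product formula is required for all words over \<open>S\<close>, including those whose
  cylinder is empty.\<close>

definition markov_measure ::
    "'a set \<Rightarrow> ('a \<Rightarrow> 'a \<Rightarrow> real) \<Rightarrow> (nat \<Rightarrow> 'a) measure \<Rightarrow> bool" where
  "markov_measure S A \<mu> \<longleftrightarrow>
     (\<exists>p. stochastic_matrix S p \<and>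
        (\<forall>w. w \<noteq> [] \<and> set w \<subseteq> S \<longrightarrow>
           emeasure \<mu> (cylinder S A w) =
             emeasure \<mu> (cylinder S A [w ! 0]) *
             ennreal (\<Prod>i<length w - 1. p (w ! i) (w ! Suc i))))"

definition alpha_deriv_measure ::
    "'a set \<Rightarrow> ('a \<Rightarrow> 'a \<Rightarrow> real) \<Rightarrow> ('a \<Rightarrow> real) \<Rightarrow> (nat \<Rightarrow> 'a) measure \<Rightarrow> bool" where
  "alpha_deriv_measure S A \<pi> \<mu> \<longleftrightarrow>
     \<mu> \<in> M_alpha S A
     \<and> shift_abs_continuous S A \<mu>
     \<and> alpha_measurable S A \<mu> (shift_deriv S A \<mu>)
     \<and> (\<forall>s\<in>S. emeasure \<mu> (cylinder S A [s]) = ennreal (\<pi> s))"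

definition Pi_sum :: "'a set \<Rightarrow> ('a \<Rightarrow> 'a \<Rightarrow> real) \<Rightarrow> ('a \<Rightarrow> real) \<Rightarrow> 'a \<Rightarrow> ennreal" where
  "Pi_sum S A \<pi> s = (\<Sum>\<^sub>\<infinity>t\<in>S. ennreal (A s t * \<pi> t))"

end

theory Submission
  imports Defs
begin

text \<open>
  Write \<open>\<Pi>(s)\<close> for the sum of \<open>A s t * \<pi> t\<close> over \<open>t\<close>, \<open>T\<close> for the shift, and \<open>[s]\<close> for the cell of \<open>s\<close>.
  The derivative of \<open>\<mu> \<circ> T\<close> equals a constant \<open>c\<close> on \<open>[s]\<close> precisely if \<open>\<mu> (T B) = c * \<mu> B\<close> for all
  measurable subsets \<open>B\<close> of \<open>[s]\<close> (\<open>constant_derivative_iff_scaling\<close>).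

  Suppose that this holds on every cell and that \<open>\<mu> [s] = \<pi> s\<close> for all \<open>s\<close>. Since \<open>T [s]\<close> is the
  disjoint union of the cells \<open>[t]\<close> with \<open>A s t = 1\<close>, taking \<open>B = [s]\<close> gives \<open>\<Pi>(s) = c * \<pi> s\<close>, while
  \<open>B = [s, t]\<close> gives \<open>\<pi> t = c * \<mu> [s, t]\<close>, so \<open>c\<close> is finite, hence so is \<open>\<Pi>(s)\<close>, and
  \<open>c = \<Pi>(s) / \<pi> s\<close> (\<open>scaling_factor\<close>). Applied to longer cylinders the scaling property becomes a
  recursion on the length of words, whose solution is the Markov formula with transition
  probabilities \<open>p s t = A s t * \<pi> t / \<Pi>(s)\<close> (\<open>emeasure_cyl\<close>). The values on cylinders determine
  \<open>\<mu>\<close>, so \<open>\<mu>\<close> is unique.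

  Conversely, if all \<open>\<Pi>(s)\<close> are finite then \<open>p\<close> is stochastic. The Markov measure with initial masses
  \<open>\<pi>\<close> and transition matrix \<open>p\<close> is constructed as the law of a random walk driven by independent
  coordinates (\<open>exists_markov_measure\<close>). It satisfies the scaling property on cylinders by the same
  recursion, hence on all measurable sets (\<open>scaling_if_markov\<close>).
\<close>

section \<open>Countable sums\<close>

lemma infsum_eq_nn_integral_count_space:
  fixes f :: "'a \<Rightarrow> ennreal"
  assumes "countable A"
  shows "infsum f A = (\<integral>\<^sup>+x. f x \<partial>count_space A)"
proof (cases "finite A")
  case True
  then show ?thesis
    by (simp add: nn_integral_count_space_finite)
next
  case False
  then have bij: "bij_betw (from_nat_into A) UNIV A"
    using bij_betw_from_nat_into[OF assms] by blast
  have "((\<lambda>n. f (from_nat_into A n)) has_sum infsum (\<lambda>n. f (from_nat_into A n)) UNIV) UNIV"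
    by (intro has_sum_infsum nonneg_summable_on_complete) simp
  then have "infsum f A = (\<Sum>n. f (from_nat_into A n))"
    unfolding infsum_reindex_bij_betw[OF bij] by (intro sums_unique has_sum_imp_sums)
  also have "\<dots> = (\<integral>\<^sup>+n. f (from_nat_into A n) \<partial>count_space UNIV)"
    by (rule nn_integral_count_space_nat[symmetric])
  also have "\<dots> = (\<integral>\<^sup>+x. f x \<partial>count_space A)"
    by (rule nn_integral_bij_count_space[OF bij])
  finally show ?thesis .
qed

lemma has_sum_real_iff_infsum_ennreal:
  fixes f :: "'a \<Rightarrow> real"
  assumes nonneg: "\<And>x. x \<in> A \<Longrightarrow> 0 \<le> f x" and "0 \<le> r"
  shows "(f has_sum r) A \<longleftrightarrow> infsum (\<lambda>x. ennreal (f x)) A = ennreal r"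
proof -
  have SUP: "infsum (\<lambda>x. ennreal (f x)) A = (SUP F\<in>{F. finite F \<and> F \<subseteq> A}. ennreal (sum f F))"
    using nonneg by (subst nonneg_infsum_complete) (auto intro!: SUP_cong sum_ennreal)
  have eq: "infsum (\<lambda>x. ennreal (f x)) A = ennreal (infsum f A)" if "f summable_on A"
    using infsum_nonneg_is_SUPREMUM_ennreal[OF that nonneg] SUP by simp
  have summable: "f summable_on A" if *: "infsum (\<lambda>x. ennreal (f x)) A = ennreal r"
  proof (rule nonneg_bdd_above_summable_on[OF nonneg])
    have "sum f F \<le> r" if "finite F" "F \<subseteq> A" for F
    proof -
      have "ennreal (sum f F) \<le> ennreal r"
        unfolding *[symmetric] SUP using that by (intro SUP_upper) auto
      then show ?thesis
        using \<open>0 \<le> r\<close> by (simp add: ennreal_le_iff)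
    qed
    then show "bdd_above (sum f ` {F. F \<subseteq> A \<and> finite F})"
      by (intro bdd_aboveI2[of _ _ r]) auto
  qed
  have "0 \<le> infsum f A"
    by (rule infsum_nonneg[OF nonneg])
  then show ?thesis
    using eq summable \<open>0 \<le> r\<close>
    by (metis ennreal_inj has_sum_infsum has_sum_imp_summable infsumI)
qed

section \<open>Cylinders and the Borel sets of a topological Markov shift\<close>

text \<open>A topological Markov shift: countable state space, transition matrix with entries in
  \<open>{0, 1}\<close>, every cell nonempty. Nonempty cells give every state an admissible successor
  (\<open>successor_exists\<close>).\<close>

locale markov_shift =
  fixes S :: "'a set" and A :: "'a \<Rightarrow> 'a \<Rightarrow> real"
  assumes is_tms: "is_tms S A"
begin

lemma countable_states: "countable S"
  using is_tms by (simp add: is_tms_def)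

lemma transition_01: "s \<in> S \<Longrightarrow> t \<in> S \<Longrightarrow> A s t = 0 \<or> A s t = 1"
  using is_tms by (auto simp: is_tms_def)

abbreviation X :: "(nat \<Rightarrow> 'a) set" where
  "X \<equiv> tms S A"

abbreviation cyl :: "'a list \<Rightarrow> (nat \<Rightarrow> 'a) set" where
  "cyl \<equiv> cylinder S A"

text \<open>The cylinders of nonempty words over \<open>S\<close>. The empty set belongs to this family only if some
  word is inadmissible, so it is added explicitly where stability under intersection is needed.\<close>

definition cylinders :: "(nat \<Rightarrow> 'a) set set" where
  "cylinders = {cyl w |w. w \<noteq> [] \<and> set w \<subseteq> S}"

lemma cylinder_subset: "cyl w \<subseteq> X"
  by (auto simp: cylinder_def)

lemma cylinders_Pow: "cylinders \<subseteq> Pow X"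
  using cylinder_subset by (auto simp: cylinders_def)

lemma cyl_in_cylinders: "w \<noteq> [] \<Longrightarrow> set w \<subseteq> S \<Longrightarrow> cyl w \<in> cylinders"
  by (auto simp: cylinders_def)

lemma cyl_Nil [simp]: "cyl [] = X"
  by (simp add: cylinder_def)

lemma mem_cyl_Cons: "x \<in> cyl (s # w) \<longleftrightarrow> x \<in> X \<and> x 0 = s \<and> shift x \<in> cyl w"
  by (auto simp: cylinder_def tms_def shift_def less_Suc_eq_0_disj)

lemma mem_cyl_single: "x \<in> cyl [s] \<longleftrightarrow> x \<in> X \<and> x 0 = s"
  by (auto simp: cylinder_def)

lemma mem_cyl_self: "x \<in> X \<Longrightarrow> x \<in> cyl [x 0]"
  by (simp add: mem_cyl_single)

lemma state_mem: "x \<in> X \<Longrightarrow> x i \<in> S"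
  by (simp add: tms_def)

lemma case_nat_mem: "case_nat s y \<in> X \<longleftrightarrow> s \<in> S \<and> A s (y 0) = 1 \<and> y \<in> X"
  by (auto simp: tms_def split: nat.split)

lemma shift_case_nat [simp]: "shift (case_nat s y) = y"
  by (simp add: shift_def)

lemma case_nat_shift: "x 0 = s \<Longrightarrow> case_nat s (shift x) = x"
  by (auto simp: shift_def split: nat.split)

lemma cyl_nonempty: "s \<in> S \<Longrightarrow> cyl [s] \<noteq> {}"
  using is_tms by (auto simp: is_tms_def alpha_def)

lemma successor_exists:
  assumes "s \<in> S"
  obtains t where "t \<in> S" "A s t = 1"
proof -
  obtain x where "x \<in> cyl [s]"
    using cyl_nonempty[OF assms] by auto
  then have "x (Suc 0) \<in> S" "A s (x (Suc 0)) = 1"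
    by (auto simp: cylinder_def tms_def)
  then show ?thesis
    by (rule that)
qed

lemma cyl_inadmissible: "A s t \<noteq> 1 \<Longrightarrow> cyl (s # t # w) = {}"
  by (auto simp: mem_cyl_Cons tms_def shift_def)

lemma countable_cylinders: "countable cylinders"
proof -
  have "cylinders \<subseteq> cyl ` lists S"
    by (auto simp: cylinders_def)
  then show ?thesis
    using countable_lists[OF countable_states] by (meson countable_image countable_subset)
qed

text \<open>Open sets are generated by arbitrary unions, but there are only countably many cylinders.
  So it suffices that each point of an open set \<open>U\<close> has a cylinder neighbourhood within \<open>U\<close>; such
  a \<open>U\<close> is then a countable union of cylinders.\<close>

lemma open_contains_cylinder:
  assumes "generate_topology_on cylinders U" "x \<in> U"
  shows "\<exists>n. cyl (map x [0..<n]) \<subseteq> U"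
  using assms
proof (induction arbitrary: x)
  case (Int U V)
  then obtain m n where "cyl (map x [0..<m]) \<subseteq> U" "cyl (map x [0..<n]) \<subseteq> V"
    by blast
  moreover have "cyl (map x [0..<max m n]) \<subseteq> cyl (map x [0..<m]) \<inter> cyl (map x [0..<n])"
    by (auto simp: cylinder_def)
  ultimately show ?case
    by blast
next
  case (Basis U)
  then obtain w where w: "U = cyl w" "w \<noteq> []"
    by (auto simp: cylinders_def)
  then have "cyl (map x [0..<length w]) \<subseteq> U"
    using Basis(2) by (auto simp: cylinder_def)
  then show ?case ..
qed blast+

lemma borel_eq_sigma_cylinders:
  "sigma_sets X {U. openin (tms_topology S A) U} = sigma_sets X cylinders"
proof (rule sigma_sets_eqI)
  have top: "openin (tms_topology S A) U \<longleftrightarrow> generate_topology_on cylinders U" for U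
    by (simp add: tms_topology_def cylinders_def openin_topology_generated_by_iff)
  fix U assume "U \<in> {U. openin (tms_topology S A) U}"
  then have U: "generate_topology_on cylinders U"
    by (simp add: top)
  have sub: "U \<subseteq> X"
    using U by induction (use cylinders_Pow in auto)
  have "U = \<Union>{C \<in> cylinders. C \<subseteq> U}"
  proof
    show "U \<subseteq> \<Union>{C \<in> cylinders. C \<subseteq> U}"
    proof
      fix x assume x: "x \<in> U"
      then obtain n where n: "cyl (map x [0..<n]) \<subseteq> U"
        using open_contains_cylinder[OF U] by blast
      let ?w = "map x [0..<Suc n]"
      have "x \<in> cyl ?w"
        using x sub by (auto simp: cylinder_def nth_append simp del: upt_Suc)
      moreover have "cyl ?w \<subseteq> cyl (map x [0..<n])"
        by (auto simp: cylinder_def nth_append less_Suc_eq)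
      moreover have "cyl ?w \<in> cylinders"
        using x sub by (intro cyl_in_cylinders) (auto simp: tms_def)
      ultimately show "x \<in> \<Union>{C \<in> cylinders. C \<subseteq> U}"
        using n by blast
    qed
  qed auto
  moreover have "\<Union>{C \<in> cylinders. C \<subseteq> U} \<in> sigma_sets X cylinders"
    using countable_cylinders
    by (intro sigma_sets_UNION countable_subset[OF _ countable_cylinders]) auto
  ultimately show "U \<in> sigma_sets X cylinders"
    by simp
next
  fix C assume "C \<in> cylinders"
  then show "C \<in> sigma_sets X {U. openin (tms_topology S A) U}"
    by (auto intro!: sigma_sets.Basic topology_generated_by_Basis
        simp: tms_topology_def cylinders_def)
qed

lemma cyl_Int_cyl:
  assumes "length v \<le> length w"
  shows "cyl v \<inter> cyl w = cyl w \<or> cyl v \<inter> cyl w = {}"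
proof (cases "\<forall>i<length v. v ! i = w ! i")
  case True
  then have "cyl w \<subseteq> cyl v"
    using assms by (auto simp: cylinder_def)
  then show ?thesis
    by blast
next
  case False
  then obtain i where "i < length v" "v ! i \<noteq> w ! i"
    by blast
  then show ?thesis
    using assms by (fastforce simp: cylinder_def)
qed

lemma Int_stable_cylinders: "Int_stable (insert {} cylinders)"
proof -
  have "cyl v \<inter> cyl w \<in> {cyl v, cyl w, {}}" for v w
    using cyl_Int_cyl[of v w] cyl_Int_cyl[of w v] by (cases "length v \<le> length w") auto
  then have "C \<inter> D \<in> {C, D, {}}" if "C \<in> cylinders" "D \<in> cylinders" for C D
    using that by (auto simp only: cylinders_def mem_Collect_eq)
  then show ?thesis
    by (intro Int_stableI) fastforce
qed

lemma sigma_sets_insert_empty: "sigma_sets X (insert {} cylinders) = sigma_sets X cylinders"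
  by (rule sigma_sets_eqI) (auto intro: sigma_sets.intros)

lemma alpha_subset_cylinders: "alpha S A \<subseteq> cylinders"
  by (auto simp: alpha_def intro!: cyl_in_cylinders)

lemma Union_alpha: "\<Union>(alpha S A) = X"
  using mem_cyl_self state_mem by (auto simp: alpha_def mem_cyl_single)

lemma countable_alpha: "countable (alpha S A)"
  using countable_states by (simp add: alpha_def)

text \<open>Cylinders form a \<open>\<pi>\<close>-system up to the empty set, and the cells are a countable cover of
  finite mass, so the values on cylinders determine a measure in \<open>M_alpha S A\<close>.\<close>

lemma measure_eqI_cylinders:
  assumes sets: "sets M = sigma_sets X cylinders" "sets N = sigma_sets X cylinders"
    and eq: "\<And>w. w \<noteq> [] \<Longrightarrow> set w \<subseteq> S \<Longrightarrow> emeasure M (cyl w) = emeasure N (cyl w)"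
    and fin: "\<And>s. s \<in> S \<Longrightarrow> emeasure M (cyl [s]) \<noteq> \<infinity>"
  shows "M = N"
proof (rule measure_eqI_generator_eq_countable[OF Int_stable_cylinders])
  show "insert {} cylinders \<subseteq> Pow X"
    using cylinders_Pow by simp
  show "emeasure M C = emeasure N C" if C: "C \<in> insert {} cylinders" for C
  proof (cases "C = {}")
    case False
    then obtain w where "C = cyl w" "w \<noteq> []" "set w \<subseteq> S"
      using C unfolding cylinders_def by blast
    then show ?thesis
      using eq by simp
  qed simp
  show "alpha S A \<subseteq> insert {} cylinders"
    using alpha_subset_cylinders by (rule subset_insertI2)
  show "emeasure M a \<noteq> \<infinity>" if "a \<in> alpha S A" for a
    using that fin unfolding alpha_def by blast
qed (simp_all only: sets sigma_sets_insert_empty Union_alpha countable_alpha)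

lemma M_alpha_iff:
  "\<mu> \<in> M_alpha S A \<longleftrightarrow>
     space \<mu> = X \<and> sets \<mu> = sigma_sets X cylinders \<and> (\<forall>s\<in>S. emeasure \<mu> (cyl [s]) < \<infinity>)"
proof -
  have "sigma_finite_measure \<mu>"
    if "space \<mu> = X" "sets \<mu> = sigma_sets X cylinders" "\<forall>s\<in>S. emeasure \<mu> (cyl [s]) < \<infinity>"
  proof
    show "\<exists>B. countable B \<and> B \<subseteq> sets \<mu> \<and> \<Union>B = space \<mu> \<and> (\<forall>a\<in>B. emeasure \<mu> a \<noteq> \<infinity>)"
    proof (intro exI conjI)
      show "alpha S A \<subseteq> sets \<mu>"
        using alpha_subset_cylinders that(2) by auto
      show "\<forall>a\<in>alpha S A. emeasure \<mu> a \<noteq> \<infinity>"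
        using that(3) by (auto simp: alpha_def)
    qed (simp_all only: Union_alpha countable_alpha that(1))
  qed
  then show ?thesis
    by (auto simp: M_alpha_def borel_eq_sigma_cylinders alpha_def)
qed

section \<open>The shift on a cell of the partition\<close>

lemma shift_image_cell: "s \<in> S \<Longrightarrow> shift ` cyl [s] = {y \<in> X. A s (y 0) = 1}"
proof (intro set_eqI iffI)
  fix y assume "s \<in> S" "y \<in> {y \<in> X. A s (y 0) = 1}"
  then have "case_nat s y \<in> cyl [s]"
    by (simp add: mem_cyl_single case_nat_mem)
  then show "y \<in> shift ` cyl [s]"
    by (metis image_eqI shift_case_nat)
qed (auto simp: mem_cyl_single tms_def shift_def)

text \<open>On the cell \<open>[s]\<close> the shift is inverted by prepending \<open>s\<close>, which is \<^term>\<open>case_nat s\<close>. Images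
  under the shift therefore become preimages, and measurability and additivity of
  \<open>B \<mapsto> \<mu> (T B)\<close> reduce to measurability of \<^term>\<open>case_nat s\<close>.\<close>

lemma shift_image:
  assumes "s \<in> S" "B \<subseteq> cyl [s]"
  shows "shift ` B = case_nat s -` B \<inter> shift ` cyl [s]"
proof (intro set_eqI iffI)
  fix y assume "y \<in> shift ` B"
  then show "y \<in> case_nat s -` B \<inter> shift ` cyl [s]"
    using assms(2) by (auto simp: mem_cyl_single subset_iff case_nat_shift)
next
  fix y assume "y \<in> case_nat s -` B \<inter> shift ` cyl [s]"
  then show "y \<in> shift ` B"
    by (metis IntD1 image_eqI shift_case_nat vimageD)
qed

lemma case_nat_vimage_cyl:
  "s \<in> S \<Longrightarrow>
    case_nat s -` cyl (t # w) \<inter> shift ` cyl [s] =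
      (if t = s then cyl w \<inter> shift ` cyl [s] else {})"
  unfolding shift_image_cell by (auto simp: mem_cyl_Cons case_nat_mem)

lemma shift_image_cell_UN:
  assumes "s \<in> S"
  shows "shift ` cyl [s] = (\<Union>t\<in>{t \<in> S. A s t = 1}. cyl [t])"
  using assms by (auto simp: shift_image_cell mem_cyl_single state_mem)

lemma cyl_Int_shift_image_cell:
  assumes "s \<in> S"
  shows "cyl (t # w) \<inter> shift ` cyl [s] = (if A s t = 1 then cyl (t # w) else {})"
  using assms by (auto simp: shift_image_cell mem_cyl_Cons)

lemma shift_image_cyl:
  assumes "s \<in> S" "A s t = 1"
  shows "shift ` cyl (s # t # w) = cyl (t # w)"
proof -
  have "cyl (s # t # w) \<subseteq> cyl [s]"
    by (auto simp: mem_cyl_Cons cylinder_def)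
  from shift_image[OF assms(1) this] show ?thesis
    using assms by (simp add: case_nat_vimage_cyl cyl_Int_shift_image_cell)
qed

end

text \<open>A measure on the shift space that is finite on the cells.\<close>

locale markov_shift_measure = markov_shift S A for S :: "'a set" and A +
  fixes \<mu> :: "(nat \<Rightarrow> 'a) measure"
  assumes in_M_alpha: "\<mu> \<in> M_alpha S A"
begin

lemma space_\<mu>: "space \<mu> = X" and sets_\<mu>: "sets \<mu> = sigma_sets X cylinders"
  and finite_cell: "s \<in> S \<Longrightarrow> emeasure \<mu> (cyl [s]) < \<infinity>"
  using in_M_alpha by (auto simp: M_alpha_iff)

lemma cyl_measurable [measurable]: "w \<noteq> [] \<Longrightarrow> set w \<subseteq> S \<Longrightarrow> cyl w \<in> sets \<mu>"
  by (auto simp: sets_\<mu> intro: cyl_in_cylinders)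

lemma cell_measurable [measurable]: "s \<in> S \<Longrightarrow> cyl [s] \<in> sets \<mu>"
  by simp

lemma shift_image_cell_measurable [measurable]: "s \<in> S \<Longrightarrow> shift ` cyl [s] \<in> sets \<mu>"
  unfolding shift_image_cell_UN
  by (intro sets.countable_UN' countable_subset[OF _ countable_states]) auto

lemma space_restrict_shift_image_cell:
  "s \<in> S \<Longrightarrow> space (restrict_space \<mu> (shift ` cyl [s])) = shift ` cyl [s]"
  by (auto simp: space_restrict_space shift_image_cell space_\<mu>)

lemma measurable_case_nat:
  assumes "s \<in> S"
  shows "case_nat s \<in> measurable (restrict_space \<mu> (shift ` cyl [s])) \<mu>"
proof (rule measurable_sigma_sets[OF sets_\<mu> cylinders_Pow])
  show "case_nat s \<in> space (restrict_space \<mu> (shift ` cyl [s])) \<rightarrow> X"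
    using assms by (auto simp: space_restrict_space case_nat_mem shift_image_cell)
  fix C assume "C \<in> cylinders"
  then obtain t w where C: "C = cyl (t # w)" "t \<in> S" "set w \<subseteq> S"
    by (auto simp: cylinders_def neq_Nil_conv)
  have "cyl w \<in> sets \<mu>"
    using C cyl_measurable[of w] sets.top[of \<mu>] by (cases "w = []") (auto simp: space_\<mu>)
  then show "case_nat s -` C \<inter> space (restrict_space \<mu> (shift ` cyl [s]))
      \<in> sets (restrict_space \<mu> (shift ` cyl [s]))"
    using assms
    by (auto simp: C case_nat_vimage_cyl sets_restrict_space_iff space_restrict_shift_image_cell)
qed

lemma measurable_case_nat_cell:
  assumes "s \<in> S"
  shows "case_nat s \<in> measurable (restrict_space \<mu> (shift ` cyl [s])) (restrict_space \<mu> (cyl [s]))"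
  using assms
  by (intro measurable_restrict_space2 measurable_case_nat)
    (simp_all add: space_restrict_shift_image_cell,
     auto simp: shift_image_cell mem_cyl_single case_nat_mem)

text \<open>The total mass of \<open>B \<mapsto> \<mu> (T B)\<close> on \<open>[s]\<close> is \<open>\<Pi>(s)\<close>, because \<open>T [s]\<close> is the disjoint union of
  the cells \<open>[t]\<close> with \<open>A s t = 1\<close>.\<close>

lemma emeasure_shift_image_cell:
  assumes "s \<in> S" and mass: "\<And>t. t \<in> S \<Longrightarrow> emeasure \<mu> (cyl [t]) = ennreal (\<pi> t)"
  shows "emeasure \<mu> (shift ` cyl [s]) = Pi_sum S A \<pi> s"
proof -
  let ?I = "{t \<in> S. A s t = 1}"
  have "emeasure \<mu> (shift ` cyl [s]) = (\<integral>\<^sup>+t. emeasure \<mu> (cyl [t]) \<partial>count_space ?I)"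
    unfolding shift_image_cell_UN[OF \<open>s \<in> S\<close>]
    by (intro emeasure_UN_countable countable_subset[OF _ countable_states])
      (auto simp: disjoint_family_on_def mem_cyl_single)
  also have "\<dots> = (\<integral>\<^sup>+t. ennreal (A s t * \<pi> t) \<partial>count_space ?I)"
    by (intro nn_integral_cong) (simp add: mass)
  also have "\<dots> = (\<integral>\<^sup>+t. ennreal (A s t * \<pi> t) \<partial>count_space S)"
    using transition_01[OF \<open>s \<in> S\<close>] by (intro nn_integral_count_space_eq) fastforce+
  also have "\<dots> = Pi_sum S A \<pi> s"
    by (simp add: Pi_sum_def infsum_eq_nn_integral_count_space[OF countable_states])
  finally show ?thesis .
qed

section \<open>Constancy of the derivative as a scaling property\<close>

lemma shift_pullback_eq_distr:
  assumes "s \<in> S"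
  shows "shift_pullback \<mu> (cyl [s]) =
    distr (restrict_space \<mu> (shift ` cyl [s])) (restrict_space \<mu> (cyl [s])) (case_nat s)"
    (is "_ = ?D")
proof -
  have cell: "cyl [s] \<inter> space \<mu> \<in> sets \<mu>" and im: "shift ` cyl [s] \<inter> space \<mu> \<in> sets \<mu>"
    using assms by (auto intro!: sets.Int)
  have "shift_pullback \<mu> (cyl [s]) = measure_of (space ?D) (sets ?D) (emeasure ?D)"
    unfolding shift_pullback_def space_distr sets_distr
  proof (rule measure_of_eq[OF sets.space_closed])
    fix B assume "B \<in> sigma_sets (space (restrict_space \<mu> (cyl [s]))) (sets (restrict_space \<mu> (cyl [s])))"
    then have B: "B \<in> sets (restrict_space \<mu> (cyl [s]))"
      by (simp add: sets.sigma_sets_eq)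
    then have "B \<subseteq> cyl [s]"
      using cell by (simp add: sets_restrict_space_iff)
    from shift_image[OF assms this] show "emeasure \<mu> (shift ` B) = emeasure ?D B"
      using assms im by (simp add: emeasure_distr[OF measurable_case_nat_cell B]
        space_restrict_shift_image_cell emeasure_restrict_space)
  qed
  then show ?thesis
    by (simp only: measure_of_of_measure)
qed

lemma sets_shift_pullback:
  "s \<in> S \<Longrightarrow> sets (shift_pullback \<mu> (cyl [s])) = sets (restrict_space \<mu> (cyl [s]))"
  by (simp add: shift_pullback_eq_distr)

lemma emeasure_shift_pullback:
  assumes "s \<in> S" "B \<in> sets \<mu>" "B \<subseteq> cyl [s]"
  shows "emeasure (shift_pullback \<mu> (cyl [s])) B = emeasure \<mu> (shift ` B)"
proof -
  have im: "shift ` cyl [s] \<inter> space \<mu> \<in> sets \<mu>"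
    using assms by auto
  have B: "B \<in> sets (restrict_space \<mu> (cyl [s]))"
    using assms by (simp add: sets_restrict_space_iff)
  show ?thesis
    using assms(1) im shift_image[OF assms(1,3)]
    by (simp add: shift_pullback_eq_distr[OF assms(1)] emeasure_distr[OF measurable_case_nat_cell B]
        space_restrict_shift_image_cell
        emeasure_restrict_space)
qed

lemma shift_pullback_eq_density_const_iff:
  assumes "s \<in> S"
  shows "shift_pullback \<mu> (cyl [s]) = density (restrict_space \<mu> (cyl [s])) (\<lambda>_. c) \<longleftrightarrow>
    (\<forall>B\<in>sets \<mu>. B \<subseteq> cyl [s] \<longrightarrow> emeasure \<mu> (shift ` B) = c * emeasure \<mu> B)"
    (is "?P = ?D \<longleftrightarrow> ?scaling")
proof -
  have sets: "B \<in> sets (restrict_space \<mu> (cyl [s])) \<longleftrightarrow> B \<in> sets \<mu> \<and> B \<subseteq> cyl [s]" for B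
    using assms by (auto simp: sets_restrict_space_iff)
  have D: "emeasure ?D B = c * emeasure \<mu> B" if "B \<in> sets \<mu>" "B \<subseteq> cyl [s]" for B
    using assms that by (simp add: emeasure_density_const sets emeasure_restrict_space)
  show ?thesis
  proof
    assume "?P = ?D"
    then show ?scaling
      using D emeasure_shift_pullback[OF assms] by auto
  next
    assume scaling: ?scaling
    show "?P = ?D"
    proof (rule measure_eqI)
      fix B assume "B \<in> sets ?P"
      then have "B \<in> sets \<mu>" "B \<subseteq> cyl [s]"
        using assms by (auto simp: sets_shift_pullback sets)
      then show "emeasure ?P B = emeasure ?D B"
        using D emeasure_shift_pullback[OF assms] scaling by auto
    qed (simp add: sets_shift_pullback[OF assms])
  qed
qed

text \<open>The Radon-Nikodym derivative disappears from the problem: it is constant on the cells if and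
  only if, on each cell, the shift multiplies the measure by a constant. A priori that constant lies
  in \<^typ>\<open>ennreal\<close> and may be infinite.\<close>

lemma constant_derivative_iff_scaling:
  "shift_abs_continuous S A \<mu> \<and> alpha_measurable S A \<mu> (shift_deriv S A \<mu>) \<longleftrightarrow>
    (\<forall>s\<in>S. \<exists>c. \<forall>B\<in>sets \<mu>. B \<subseteq> cyl [s] \<longrightarrow> emeasure \<mu> (shift ` B) = c * emeasure \<mu> B)"
proof -
  let ?R = "\<lambda>s. restrict_space \<mu> (cyl [s])" and ?P = "\<lambda>s. shift_pullback \<mu> (cyl [s])"
  have AE: "(AE x in \<mu>. x \<in> cyl [s] \<longrightarrow> shift_deriv S A \<mu> x = c) \<longleftrightarrow>
      (AE x in ?R s. RN_deriv (?R s) (?P s) x = c)" if "s \<in> S" for s c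
  proof -
    have "(AE x in \<mu>. x \<in> cyl [s] \<longrightarrow> shift_deriv S A \<mu> x = c) \<longleftrightarrow>
        (AE x in \<mu>. x \<in> cyl [s] \<longrightarrow> RN_deriv (?R s) (?P s) x = c)"
      by (intro AE_cong) (auto simp: shift_deriv_def mem_cyl_single)
    then show ?thesis
      using that by (simp add: AE_restrict_space_iff)
  qed
  have "absolutely_continuous (?R s) (?P s) \<and>
      (\<exists>c. AE x in \<mu>. x \<in> cyl [s] \<longrightarrow> shift_deriv S A \<mu> x = c) \<longleftrightarrow>
      (\<exists>c. ?P s = density (?R s) (\<lambda>_. c))" if s: "s \<in> S" for s
  proof -
    have "emeasure (?R s) (space (?R s)) \<noteq> \<infinity>"
      using s finite_cell[OF s]
      by (simp add: space_restrict_space emeasure_restrict_space space_\<mu>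
          Int_absorb2[OF cylinder_subset])
    then interpret finite_measure "?R s"
      by (rule finite_measureI)
    show ?thesis
    proof (intro iffI conjI; (elim conjE)?)
      assume ac: "absolutely_continuous (?R s) (?P s)"
        and "\<exists>c. AE x in \<mu>. x \<in> cyl [s] \<longrightarrow> shift_deriv S A \<mu> x = c"
      then obtain c where c: "AE x in ?R s. RN_deriv (?R s) (?P s) x = c"
        using AE[OF s] by auto
      have "?P s = density (?R s) (RN_deriv (?R s) (?P s))"
        using density_RN_deriv[OF ac sets_shift_pullback[OF s]] by simp
      also have "\<dots> = density (?R s) (\<lambda>_. c)"
        by (intro density_cong c) simp_all
      finally show "\<exists>c. ?P s = density (?R s) (\<lambda>_. c)" ..
    next
      assume "\<exists>c. ?P s = density (?R s) (\<lambda>_. c)"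
      then show "absolutely_continuous (?R s) (?P s)"
        by (auto intro!: absolutely_continuousI_density)
    next
      assume "\<exists>c. ?P s = density (?R s) (\<lambda>_. c)"
      then obtain c where "?P s = density (?R s) (\<lambda>_. c)" ..
      then have "AE x in ?R s. c = RN_deriv (?R s) (?P s) x"
        by (intro RN_deriv_unique) simp_all
      then have "AE x in ?R s. RN_deriv (?R s) (?P s) x = c"
        by eventually_elim simp
      then show "\<exists>c. AE x in \<mu>. x \<in> cyl [s] \<longrightarrow> shift_deriv S A \<mu> x = c"
        using AE[OF s] by auto
    qed
  qed
  then show ?thesis
    unfolding shift_abs_continuous_def alpha_measurable_def alpha_def
    by (auto simp: shift_pullback_eq_density_const_iff[symmetric])
qed

end

section \<open>Existence of Markov measures\<close>

text \<open>The product of the transition probabilities along a word; it is \<open>1\<close> for words of length at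
  most \<open>1\<close>.\<close>

definition path_weight :: "('a \<Rightarrow> 'a \<Rightarrow> real) \<Rightarrow> 'a list \<Rightarrow> real" where
  "path_weight p w = (\<Prod>i<length w - 1. p (w ! i) (w ! Suc i))"

lemma path_weight_single [simp]: "path_weight p [s] = 1"
  by (simp add: path_weight_def)

lemma path_weight_Cons: "path_weight p (s # t # w) = p s t * path_weight p (t # w)"
  by (simp add: path_weight_def prod.lessThan_Suc_shift del: prod.lessThan_Suc)

text \<open>The path started at \<open>s\<close> that, being at the state \<open>t\<close> at time \<open>n\<close>, moves on to \<open>\<omega> (n, t)\<close>. With
  independent coordinates \<open>\<omega> (n, t)\<close> of law \<open>p t\<close> this is the Markov chain with transition matrix
  \<open>p\<close>.\<close>

primrec walk :: "'a \<Rightarrow> (nat \<times> 'a \<Rightarrow> 'a) \<Rightarrow> nat \<Rightarrow> 'a" where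
  "walk s \<omega> 0 = s"
| "walk s \<omega> (Suc n) = \<omega> (n, walk s \<omega> n)"

text \<open>Following a given word constrains the coordinates \<open>(i, w ! i)\<close> only. They are pairwise distinct,
  hence independent, which turns the probability of a cylinder into a product.\<close>

lemma walk_follows_iff:
  assumes "w \<noteq> []"
  shows "(\<forall>i<length w. walk s \<omega> i = w ! i) \<longleftrightarrow>
    s = w ! 0 \<and> (\<forall>i<length w - 1. \<omega> (i, w ! i) = w ! Suc i)"
proof (intro iffI conjI allI impI)
  assume *: "\<forall>i<length w. walk s \<omega> i = w ! i"
  then show "s = w ! 0"
    using assms by force
  fix i assume "i < length w - 1"
  then show "\<omega> (i, w ! i) = w ! Suc i"
    using *[rule_format, of i] *[rule_format, of "Suc i"] by simp
next
  fix i assume *: "s = w ! 0 \<and> (\<forall>i<length w - 1. \<omega> (i, w ! i) = w ! Suc i)" and "i < length w"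
  from this(2) show "walk s \<omega> i = w ! i"
    by (induction i) (use * in auto)
qed

context markov_shift
begin

text \<open>The law of the coordinate \<open>\<omega> (n, t)\<close>. Its space consists of the admissible successors of \<open>t\<close>, so
  that walks stay in the shift space for every \<open>\<omega>\<close> and not only almost surely. For \<open>t\<close> outside
  \<open>S\<close> an arbitrary probability space serves, as a walk started in \<open>S\<close> never reads that coordinate.\<close>

definition step_space :: "('a \<Rightarrow> 'a \<Rightarrow> real) \<Rightarrow> nat \<times> 'a \<Rightarrow> 'a measure" where
  "step_space p j = (if snd j \<in> S
     then point_measure {t \<in> S. A (snd j) t = 1} (\<lambda>t. ennreal (p (snd j) t))
     else count_space {undefined})"

lemma walk_mem:
  assumes "\<omega> \<in> space (PiM UNIV (step_space p))" "s \<in> S"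
  shows "walk s \<omega> \<in> X"
proof -
  have step: "\<omega> (n, t) \<in> S \<and> A t (\<omega> (n, t)) = 1" if "t \<in> S" for n t
  proof -
    have "\<omega> (n, t) \<in> space (step_space p (n, t))"
      using assms(1) by (auto simp: space_PiM)
    then show ?thesis
      using that by (simp add: step_space_def space_point_measure)
  qed
  have "walk s \<omega> n \<in> S" for n
    by (induction n) (use step \<open>s \<in> S\<close> in auto)
  then show ?thesis
    using step by (simp add: tms_def)
qed

lemma follow_event_measurable:
  assumes "set w \<subseteq> S"
  shows "{\<omega> \<in> space (PiM UNIV (step_space p)). \<forall>i<length w - 1. \<omega> (i, w ! i) = w ! Suc i}
    \<in> sets (PiM UNIV (step_space p))"
proof -
  let ?\<Omega> = "PiM UNIV (step_space p)"
  have "{\<omega> \<in> space ?\<Omega>. \<omega> (i, w ! i) = w ! Suc i} \<in> sets ?\<Omega>" if "i < length w - 1" for i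
  proof -
    have "w ! i \<in> S"
      using assms that by (intro subsetD[OF assms] nth_mem) simp
    then have "{w ! Suc i} \<inter> space (step_space p (i, w ! i)) \<in> sets (step_space p (i, w ! i))"
      by (auto simp: step_space_def sets_point_measure space_point_measure)
    then have "(\<lambda>\<omega>. \<omega> (i, w ! i)) -` ({w ! Suc i} \<inter> space (step_space p (i, w ! i))) \<inter> space ?\<Omega>
        \<in> sets ?\<Omega>"
      by (intro measurable_sets[OF measurable_component_singleton]) auto
    also have "(\<lambda>\<omega>. \<omega> (i, w ! i)) -` ({w ! Suc i} \<inter> space (step_space p (i, w ! i))) \<inter> space ?\<Omega> =
        {\<omega> \<in> space ?\<Omega>. \<omega> (i, w ! i) = w ! Suc i}"
      by (auto simp: space_PiM PiE_iff)
    finally show ?thesis .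
  qed
  then have "{\<omega> \<in> space ?\<Omega>. \<forall>i\<in>{..<length w - 1}. \<omega> (i, w ! i) = w ! Suc i} \<in> sets ?\<Omega>"
    by (intro sets.sets_Collect_finite_All) auto
  then show ?thesis
    by (simp only: Ball_def lessThan_iff)
qed

lemma cyl_inadmissible_word:
  assumes "\<not> (\<forall>i<length w - 1. A (w ! i) (w ! Suc i) = 1)"
  shows "cyl w = {}"
proof -
  have "A (w ! i) (w ! Suc i) = 1" if "x \<in> cyl w" "i < length w - 1" for x i
  proof -
    have "A (x i) (x (Suc i)) = 1"
      using that(1) by (simp add: cylinder_def tms_def)
    moreover have "x i = w ! i" "x (Suc i) = w ! Suc i"
      using that by (auto simp: cylinder_def)
    ultimately show ?thesis
      by simp
  qed
  then show ?thesis
    using assms by blast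
qed

text \<open>The measure is the law of the walk with initial distribution \<open>q\<close>. Since \<open>q\<close> may have infinite
  total mass, the initial state contributes a \<open>\<sigma>\<close>-finite factor to the product with the probability
  space of the coordinates.\<close>

lemma exists_markov_measure:
  fixes q :: "'a \<Rightarrow> real"
  assumes stoch: "stochastic_matrix S p"
    and supp: "\<And>s t. s \<in> S \<Longrightarrow> t \<in> S \<Longrightarrow> A s t \<noteq> 1 \<Longrightarrow> p s t = 0"
  obtains \<mu> where "space \<mu> = X" "sets \<mu> = sigma_sets X cylinders"
    "\<And>w. w \<noteq> [] \<Longrightarrow> set w \<subseteq> S \<Longrightarrow> emeasure \<mu> (cyl w) = ennreal (q (w ! 0)) * ennreal (path_weight p w)"
proof -
  let ?\<Omega> = "PiM UNIV (step_space p)" and ?I = "point_measure S (\<lambda>s. ennreal (q s))"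
  have p_nonneg: "0 \<le> p s t" if "s \<in> S" "t \<in> S" for s t
    using stoch that by (simp add: stochastic_matrix_def)
  have prob: "prob_space (step_space p j)" for j
  proof (cases "snd j \<in> S")
    case True
    let ?s = "snd j" let ?E = "{t \<in> S. A ?s t = 1}"
    have "infsum (\<lambda>t. ennreal (p ?s t)) S = ennreal 1"
      using True stoch
      by (subst has_sum_real_iff_infsum_ennreal[symmetric]) (auto simp: stochastic_matrix_def)
    moreover have "infsum (\<lambda>t. ennreal (p ?s t)) S = (\<integral>\<^sup>+t. ennreal (p ?s t) \<partial>count_space S)"
      by (rule infsum_eq_nn_integral_count_space[OF countable_states])
    moreover have "(\<integral>\<^sup>+t. ennreal (p ?s t) \<partial>count_space S) = (\<integral>\<^sup>+t. ennreal (p ?s t) \<partial>count_space ?E)"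
      using supp[OF True] by (intro nn_integral_count_space_eq) auto
    moreover have "emeasure (point_measure ?E (\<lambda>t. ennreal (p ?s t))) ?E =
        (\<integral>\<^sup>+t. ennreal (p ?s t) \<partial>count_space ?E)"
      by (auto simp: point_measure_def emeasure_density intro!: nn_integral_cong)
    ultimately show ?thesis
      using True by (intro prob_spaceI) (simp add: step_space_def space_point_measure)
  next
    case False
    then show ?thesis
      by (intro prob_spaceI) (simp add: step_space_def)
  qed
  interpret product_prob_space "step_space p" UNIV
    by (intro product_prob_spaceI prob)
  let ?\<mu> = "distr (?I \<Otimes>\<^sub>M ?\<Omega>) (sigma X cylinders) (\<lambda>(s, \<omega>). walk s \<omega>)"
  let ?F = "\<lambda>w. {\<omega> \<in> space ?\<Omega>. \<forall>i<length w - 1. \<omega> (i, w ! i) = w ! Suc i}"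
  have space: "space (?I \<Otimes>\<^sub>M ?\<Omega>) = S \<times> space ?\<Omega>"
    by (simp add: space_pair_measure space_point_measure)
  have walk: "walk s \<omega> \<in> X" if "(s, \<omega>) \<in> space (?I \<Otimes>\<^sub>M ?\<Omega>)" for s \<omega>
    using that walk_mem by (auto simp: space)
  have vimage: "(\<lambda>(s, \<omega>). walk s \<omega>) -` cyl w \<inter> space (?I \<Otimes>\<^sub>M ?\<Omega>) = {w ! 0} \<times> ?F w"
    if w: "w \<noteq> []" "set w \<subseteq> S" for w
  proof -
    have "w ! 0 \<in> S"
      using w by (metis length_greater_0_conv nth_mem subsetD)
    moreover have "walk s \<omega> \<in> cyl w \<longleftrightarrow> s = w ! 0 \<and> \<omega> \<in> ?F w"
      if "(s, \<omega>) \<in> space (?I \<Otimes>\<^sub>M ?\<Omega>)" for s \<omega>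
      using walk[OF that] walk_follows_iff[OF w(1), of s \<omega>] that by (auto simp: cylinder_def space)
    ultimately show ?thesis
      by (fastforce simp: space)
  qed
  have initial: "{w ! 0} \<in> sets ?I" if "w \<noteq> []" "set w \<subseteq> S" for w
    using that by (auto simp: sets_point_measure)
  have meas: "(\<lambda>(s, \<omega>). walk s \<omega>) \<in> measurable (?I \<Otimes>\<^sub>M ?\<Omega>) (sigma X cylinders)"
  proof (rule measurable_sigma_sets[OF sets_measure_of[OF cylinders_Pow] cylinders_Pow])
    show "(\<lambda>(s, \<omega>). walk s \<omega>) \<in> space (?I \<Otimes>\<^sub>M ?\<Omega>) \<rightarrow> X"
      using walk by auto
    fix C assume "C \<in> cylinders"
    then obtain w where w: "C = cyl w" "w \<noteq> []" "set w \<subseteq> S"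
      unfolding cylinders_def by blast
    then show "(\<lambda>(s, \<omega>). walk s \<omega>) -` C \<inter> space (?I \<Otimes>\<^sub>M ?\<Omega>) \<in> sets (?I \<Otimes>\<^sub>M ?\<Omega>)"
      using vimage[OF w(2,3)] initial[OF w(2,3)] follow_event_measurable[OF w(3), of p]
      by (simp only: pair_measureI)
  qed
  have follow: "emeasure ?\<Omega> (?F w) = ennreal (path_weight p w)"
    if w: "set w \<subseteq> S" and adm: "\<forall>i<length w - 1. A (w ! i) (w ! Suc i) = 1" for w
  proof -
    let ?J = "(\<lambda>i. (i, w ! i)) ` {..<length w - 1}"
    have S: "w ! i \<in> S" "w ! Suc i \<in> S" if "i < length w - 1" for i
      using that by (auto intro!: subsetD[OF w] nth_mem)
    have mem: "{w ! Suc i} \<in> sets (step_space p (i, w ! i))"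
      "emeasure (step_space p (i, w ! i)) {w ! Suc i} = ennreal (p (w ! i) (w ! Suc i))"
      if "i < length w - 1" for i
      using S[OF that] adm that
      by (auto simp: step_space_def sets_point_measure emeasure_point_measure_finite2)
    have "?F w = {\<omega> \<in> space ?\<Omega>. \<forall>j\<in>?J. \<omega> j \<in> {w ! Suc (fst j)}}"
      by auto
    then have "emeasure ?\<Omega> (?F w) = (\<Prod>j\<in>?J. emeasure (step_space p j) {w ! Suc (fst j)})"
      using mem(1) by (simp only:, intro emeasure_PiM_Collect) auto
    also have "\<dots> = (\<Prod>i<length w - 1. emeasure (step_space p (i, w ! i)) {w ! Suc i})"
      by (subst prod.reindex) (auto simp: inj_on_def)
    also have "\<dots> = (\<Prod>i<length w - 1. ennreal (p (w ! i) (w ! Suc i)))"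
      using mem(2) by (intro prod.cong) auto
    also have "\<dots> = ennreal (path_weight p w)"
      unfolding path_weight_def using S p_nonneg by (intro prod_ennreal) auto
    finally show ?thesis .
  qed
  show ?thesis
  proof (rule that)
    show "space ?\<mu> = X" "sets ?\<mu> = sigma_sets X cylinders"
      using cylinders_Pow by (simp_all add: space_measure_of)
    fix w assume w: "w \<noteq> []" "set w \<subseteq> S"
    show "emeasure ?\<mu> (cyl w) = ennreal (q (w ! 0)) * ennreal (path_weight p w)"
    proof (cases "\<forall>i<length w - 1. A (w ! i) (w ! Suc i) = 1")
      case True
      have "cyl w \<in> sets (sigma X cylinders)"
        using w cylinders_Pow by (simp add: cyl_in_cylinders)
      then have "emeasure ?\<mu> (cyl w) = emeasure (?I \<Otimes>\<^sub>M ?\<Omega>) ({w ! 0} \<times> ?F w)"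
        by (simp only: emeasure_distr[OF meas] vimage[OF w])
      also have "\<dots> = emeasure ?I {w ! 0} * emeasure ?\<Omega> (?F w)"
        by (intro emeasure_pair_measure_Times initial[OF w] follow_event_measurable w)
      also have "emeasure ?I {w ! 0} = ennreal (q (w ! 0))"
        using initial[OF w] by (subst emeasure_point_measure_finite2) (auto simp: sets_point_measure)
      finally show ?thesis
        by (simp only: follow[OF w(2) True])
    next
      case False
      then obtain i where i: "i < length w - 1" "A (w ! i) (w ! Suc i) \<noteq> 1"
        by blast
      have "p (w ! i) (w ! Suc i) = 0"
        using i by (intro supp) (auto intro!: subsetD[OF w(2)] nth_mem)
      then have "path_weight p w = 0"
        using i(1) unfolding path_weight_def by (intro prod_zero) auto
      then show ?thesis
        by (simp add: cyl_inadmissible_word[OF False])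
    qed
  qed
qed

end

section \<open>The Markov measure determined by the masses of the cells\<close>

text \<open>The transition matrix \<open>p s t = A s t * \<pi> t / \<Pi>(s)\<close> of the Markov measure. If \<open>\<Pi>(s)\<close> is infinite,
  the denominator is \<open>0\<close> and the row vanishes.\<close>

definition transition_prob :: "'a set \<Rightarrow> ('a \<Rightarrow> 'a \<Rightarrow> real) \<Rightarrow> ('a \<Rightarrow> real) \<Rightarrow> 'a \<Rightarrow> 'a \<Rightarrow> real" where
  "transition_prob S A \<pi> s t = A s t * \<pi> t / enn2real (Pi_sum S A \<pi> s)"

text \<open>A topological Markov shift with prescribed positive masses of the cells.\<close>

locale weighted_markov_shift = markov_shift S A for S :: "'a set" and A +
  fixes \<pi> :: "'a \<Rightarrow> real"
  assumes \<pi>_pos: "s \<in> S \<Longrightarrow> 0 < \<pi> s"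
begin

abbreviation p :: "'a \<Rightarrow> 'a \<Rightarrow> real" where
  "p \<equiv> transition_prob S A \<pi>"

lemma edge_weight_nonneg: "s \<in> S \<Longrightarrow> t \<in> S \<Longrightarrow> 0 \<le> A s t * \<pi> t"
  using transition_01[of s t] \<pi>_pos[of t] by auto

lemma transition_prob_nonneg: "s \<in> S \<Longrightarrow> t \<in> S \<Longrightarrow> 0 \<le> p s t"
  by (simp add: transition_prob_def edge_weight_nonneg)

lemma path_weight_nonneg:
  assumes "set w \<subseteq> S"
  shows "0 \<le> path_weight p w"
  unfolding path_weight_def
  by (intro prod_nonneg transition_prob_nonneg ballI subsetD[OF assms] nth_mem) auto

lemma Pi_sum_pos:
  assumes "s \<in> S"
  shows "0 < Pi_sum S A \<pi> s"
proof -
  obtain t where t: "t \<in> S" "A s t = 1"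
    using successor_exists[OF assms] .
  have "0 < ennreal (A s t * \<pi> t)"
    using t \<pi>_pos by simp
  also have "\<dots> = sum (\<lambda>t. ennreal (A s t * \<pi> t)) {t}"
    by simp
  also have "\<dots> \<le> (SUP F\<in>{F. finite F \<and> F \<subseteq> S}. sum (\<lambda>t. ennreal (A s t * \<pi> t)) F)"
    using t by (intro SUP_upper) auto
  also have "\<dots> = Pi_sum S A \<pi> s"
    unfolding Pi_sum_def by (rule nonneg_infsum_complete[symmetric]) simp
  finally show ?thesis .
qed

lemma Pi_sum_real:
  assumes "s \<in> S" "Pi_sum S A \<pi> s < \<infinity>"
  obtains R where "0 < R" "Pi_sum S A \<pi> s = ennreal R" "enn2real (Pi_sum S A \<pi> s) = R"
  using Pi_sum_pos[OF assms(1)] assms(2)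
  by (cases "Pi_sum S A \<pi> s" rule: ennreal_cases) auto

lemma stochastic_transition_prob:
  assumes finite: "\<forall>s\<in>S. Pi_sum S A \<pi> s < \<infinity>"
  shows "stochastic_matrix S p"
  unfolding stochastic_matrix_def
proof (intro ballI conjI)
  fix s assume s: "s \<in> S"
  then obtain R where R: "0 < R" "Pi_sum S A \<pi> s = ennreal R" "enn2real (Pi_sum S A \<pi> s) = R"
    using finite by (metis Pi_sum_real)
  have "((\<lambda>t. A s t * \<pi> t) has_sum R) S"
    using R(1,2) s
    by (subst has_sum_real_iff_infsum_ennreal) (auto simp: edge_weight_nonneg Pi_sum_def)
  then have "((\<lambda>t. A s t * \<pi> t * (1 / R)) has_sum R * (1 / R)) S"
    by (rule has_sum_cmult_left)
  then show "(p s has_sum 1) S"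
    using R(1) by (simp add: transition_prob_def[abs_def] R(3))
qed (simp add: transition_prob_nonneg)

lemma transition_prob_supported: "s \<in> S \<Longrightarrow> t \<in> S \<Longrightarrow> A s t \<noteq> 1 \<Longrightarrow> p s t = 0"
  using transition_01[of s t] by (simp add: transition_prob_def)

text \<open>The recursion satisfied by the Markov formula under one shift, with scaling factor
  \<open>\<Pi>(s) / \<pi> s\<close>.\<close>

lemma step_scaling:
  assumes "s \<in> S" "t \<in> S" "A s t = 1" "set w \<subseteq> S"
    and R: "0 < R" "enn2real (Pi_sum S A \<pi> s) = R"
  shows "ennreal (R / \<pi> s) * (ennreal (\<pi> s) * ennreal (path_weight p (s # t # w))) =
    ennreal (\<pi> t) * ennreal (path_weight p (t # w))"
proof -
  have "0 \<le> path_weight p (t # w)"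
    using assms by (intro path_weight_nonneg) auto
  moreover have "R / \<pi> s * (\<pi> s * (\<pi> t / R * path_weight p (t # w))) = \<pi> t * path_weight p (t # w)"
    using R(1) \<pi>_pos[OF assms(1)] by simp
  ultimately show ?thesis
    using R(1) \<pi>_pos[OF assms(1)] \<pi>_pos[OF assms(2)]
    by (simp add: path_weight_Cons transition_prob_def R(2) assms(3) flip: ennreal_mult)
qed

lemma alpha_deriv_measure_iff:
  "alpha_deriv_measure S A \<pi> \<mu> \<longleftrightarrow>
    \<mu> \<in> M_alpha S A \<and>
    (\<forall>s\<in>S. \<exists>c. \<forall>B\<in>sets \<mu>. B \<subseteq> cyl [s] \<longrightarrow> emeasure \<mu> (shift ` B) = c * emeasure \<mu> B) \<and>
    (\<forall>s\<in>S. emeasure \<mu> (cyl [s]) = ennreal (\<pi> s))"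
proof (cases "\<mu> \<in> M_alpha S A")
  case True
  then interpret markov_shift_measure S A \<mu>
    by unfold_locales
  show ?thesis
    using constant_derivative_iff_scaling by (auto simp: alpha_deriv_measure_def)
qed (simp add: alpha_deriv_measure_def)

text \<open>The scaling factor on \<open>[s]\<close> is finite and equals \<open>\<Pi>(s) / \<pi> s\<close>. In particular \<open>\<Pi>(s)\<close> is
  finite.\<close>

lemma scaling_factor:
  assumes \<mu>: "alpha_deriv_measure S A \<pi> \<mu>" and s: "s \<in> S"
  obtains R where "0 < R" "Pi_sum S A \<pi> s = ennreal R"
    "\<And>B. B \<in> sets \<mu> \<Longrightarrow> B \<subseteq> cyl [s] \<Longrightarrow>
      emeasure \<mu> (shift ` B) = ennreal (R / \<pi> s) * emeasure \<mu> B"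
proof -
  interpret markov_shift_measure S A \<mu>
    using \<mu> by unfold_locales (simp add: alpha_deriv_measure_iff)
  have mass: "\<And>t. t \<in> S \<Longrightarrow> emeasure \<mu> (cyl [t]) = ennreal (\<pi> t)"
    using \<mu> by (simp add: alpha_deriv_measure_iff)
  obtain c where c: "\<And>B. B \<in> sets \<mu> \<Longrightarrow> B \<subseteq> cyl [s] \<Longrightarrow>
      emeasure \<mu> (shift ` B) = c * emeasure \<mu> B"
    using \<mu> s by (metis alpha_deriv_measure_iff)
  have Pi: "Pi_sum S A \<pi> s = c * ennreal (\<pi> s)"
    using c[of "cyl [s]"] emeasure_shift_image_cell[OF s mass] s by (simp add: mass)
  obtain t where t: "t \<in> S" "A s t = 1"
    using successor_exists[OF s] .
  have "cyl [s, t] \<subseteq> cyl [s]"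
    by (auto simp: mem_cyl_Cons)
  then have "ennreal (\<pi> t) = c * emeasure \<mu> (cyl [s, t])"
    using c[of "cyl [s, t]"] s t by (simp add: shift_image_cyl mass)
  \<comment> \<open>An infinite factor would make \<open>\<mu> (T [s, t]) = \<pi> t\<close> either zero or infinite.\<close>
  then have "c \<noteq> \<infinity>"
    using \<pi>_pos[OF t(1)] by (auto simp: ennreal_top_mult split: if_splits)
  then obtain r where r: "c = ennreal r" "0 \<le> r"
    by (cases c rule: ennreal_cases) auto
  have "Pi_sum S A \<pi> s = ennreal (r * \<pi> s)"
    using Pi r \<pi>_pos[OF s] by (simp add: ennreal_mult)
  moreover from this have "0 < r * \<pi> s"
    using Pi_sum_pos[OF s] by simp
  moreover have "r = r * \<pi> s / \<pi> s"
    using \<pi>_pos[OF s] by simp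
  ultimately show ?thesis
    using that c r(1) by metis
qed

lemma emeasure_cyl:
  assumes \<mu>: "alpha_deriv_measure S A \<pi> \<mu>" and "w \<noteq> []" "set w \<subseteq> S"
  shows "emeasure \<mu> (cyl w) = ennreal (\<pi> (w ! 0)) * ennreal (path_weight p w)"
  using assms(2,3)
proof (induction w rule: induct_list012)
  case (2 s)
  then show ?case
    using \<mu> by (simp add: alpha_deriv_measure_iff)
next
  case (3 s t w)
  interpret markov_shift_measure S A \<mu>
    using \<mu> by unfold_locales (simp add: alpha_deriv_measure_iff)
  have S: "s \<in> S" "t \<in> S" "set w \<subseteq> S"
    using 3 by auto
  show ?case
  proof (cases "A s t = 1")
    case True
    obtain R where R: "0 < R" "Pi_sum S A \<pi> s = ennreal R"
      and scaling: "\<And>B. B \<in> sets \<mu> \<Longrightarrow> B \<subseteq> cyl [s] \<Longrightarrow>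
        emeasure \<mu> (shift ` B) = ennreal (R / \<pi> s) * emeasure \<mu> B"
      using scaling_factor[OF \<mu> S(1)] by metis
    have "cyl (s # t # w) \<subseteq> cyl [s]"
      by (auto simp: mem_cyl_Cons cylinder_def)
    then have "ennreal (R / \<pi> s) * emeasure \<mu> (cyl (s # t # w)) = emeasure \<mu> (cyl (t # w))"
      using scaling[of "cyl (s # t # w)"] S True by (simp add: shift_image_cyl)
    also have "\<dots> = ennreal (\<pi> t) * ennreal (path_weight p (t # w))"
      using "3.IH"(2) S by simp
    also have "\<dots> = ennreal (R / \<pi> s) * (ennreal (\<pi> s) * ennreal (path_weight p (s # t # w)))"
      using S True R by (intro step_scaling[symmetric]) auto
    finally show ?thesis
      using R(1) \<pi>_pos[OF S(1)] by (simp add: ennreal_mult_cancel_left)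
  next
    case False
    then show ?thesis
      using S by (simp add: cyl_inadmissible path_weight_Cons transition_prob_supported)
  qed
qed simp

lemma alpha_deriv_measure_unique:
  assumes "alpha_deriv_measure S A \<pi> \<mu>" "alpha_deriv_measure S A \<pi> \<nu>"
  shows "\<mu> = \<nu>"
proof (rule measure_eqI_cylinders)
  show "sets \<mu> = sigma_sets X cylinders" "sets \<nu> = sigma_sets X cylinders"
    using assms by (auto simp: alpha_deriv_measure_iff M_alpha_iff)
  show "emeasure \<mu> (cyl w) = emeasure \<nu> (cyl w)" if "w \<noteq> []" "set w \<subseteq> S" for w
    using that assms by (simp add: emeasure_cyl)
  show "emeasure \<mu> (cyl [s]) \<noteq> \<infinity>" if "s \<in> S" for s
    using that assms(1) by (simp add: alpha_deriv_measure_iff)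
qed

lemma markov_alpha_deriv_measure:
  assumes \<mu>: "alpha_deriv_measure S A \<pi> \<mu>"
  shows "markov_measure S A \<mu>"
  unfolding markov_measure_def
proof (intro exI conjI allI impI)
  show "stochastic_matrix S p"
    using scaling_factor[OF \<mu>] by (intro stochastic_transition_prob) (metis ennreal_less_top infinity_ennreal_def)
  fix w assume w: "w \<noteq> [] \<and> set w \<subseteq> S"
  then have "w ! 0 \<in> S"
    by (metis length_greater_0_conv nth_mem subsetD)
  then have "emeasure \<mu> (cyl [w ! 0]) = ennreal (\<pi> (w ! 0))"
    using \<mu> by (simp add: alpha_deriv_measure_iff)
  then show "emeasure \<mu> (cyl w) =
      emeasure \<mu> (cyl [w ! 0]) * ennreal (\<Prod>i<length w - 1. p (w ! i) (w ! Suc i))"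
    using emeasure_cyl[OF \<mu>] w by (simp add: path_weight_def)
qed

text \<open>The converse: the Markov formula implies the scaling property. Both sides are measures in
  \<open>B\<close>, realised on the whole shift space as \<open>?M\<close> and \<open>?N\<close> below, and they agree on cylinders.\<close>

lemma scaling_if_markov:
  assumes \<mu>: "\<mu> \<in> M_alpha S A"
    and formula: "\<And>w. w \<noteq> [] \<Longrightarrow> set w \<subseteq> S \<Longrightarrow>
      emeasure \<mu> (cyl w) = ennreal (\<pi> (w ! 0)) * ennreal (path_weight p w)"
    and s: "s \<in> S" and R: "0 < R" "Pi_sum S A \<pi> s = ennreal R"
    and B: "B \<in> sets \<mu>" "B \<subseteq> cyl [s]"
  shows "emeasure \<mu> (shift ` B) = ennreal (R / \<pi> s) * emeasure \<mu> B"
proof -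
  interpret markov_shift_measure S A \<mu>
    using \<mu> by unfold_locales
  let ?c = "ennreal (R / \<pi> s)"
  \<comment> \<open>\<open>?M C = \<mu> (T (C \<inter> [s]))\<close> and \<open>?N C = ?c * \<mu> (C \<inter> [s])\<close>\<close>
  let ?M = "distr (restrict_space \<mu> (shift ` cyl [s])) \<mu> (case_nat s)"
  let ?N = "density \<mu> (\<lambda>x. ?c * indicator (cyl [s]) x)"
  have mass: "\<And>t. t \<in> S \<Longrightarrow> emeasure \<mu> (cyl [t]) = ennreal (\<pi> t)"
    by (simp add: formula)
  have im: "shift ` cyl [s] \<inter> space \<mu> \<in> sets \<mu>"
    using s by (auto intro!: sets.Int)
  have M: "emeasure ?M C = emeasure \<mu> (case_nat s -` C \<inter> shift ` cyl [s])" if "C \<in> sets \<mu>" for C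
    using s im that
    by (simp add: emeasure_distr[OF measurable_case_nat] space_restrict_shift_image_cell
        emeasure_restrict_space)
  have N: "emeasure ?N C = ?c * emeasure \<mu> (cyl [s] \<inter> C)" if "C \<in> sets \<mu>" for C
  proof -
    have "emeasure ?N C = (\<integral>\<^sup>+x. ?c * indicator (cyl [s] \<inter> C) x \<partial>\<mu>)"
      using s that
      by (subst emeasure_density) (auto intro!: nn_integral_cong simp: indicator_inter_arith mult.assoc)
    then show ?thesis
      using s that by (simp add: nn_integral_cmult_indicator)
  qed
  have cell: "?c * ennreal (\<pi> s) = ennreal R"
    using R(1) \<pi>_pos[OF s] by (simp flip: ennreal_mult)
  have eq: "emeasure ?M (cyl w) = emeasure ?N (cyl w)" if w: "w \<noteq> []" "set w \<subseteq> S" for w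
  proof -
    obtain t v where tv: "w = t # v" "t \<in> S" "set v \<subseteq> S"
      using w by (cases w) auto
    consider "t \<noteq> s" | "t = s" "v = []" | u v' where "t = s" "v = u # v'"
      by (cases v) auto
    then show ?thesis
    proof cases
      case 1
      then have "cyl [s] \<inter> cyl w = {}"
        by (auto simp: tv mem_cyl_Cons)
      then show ?thesis
        using M[OF cyl_measurable[OF w]] N[OF cyl_measurable[OF w]] 1 s
        by (simp add: tv case_nat_vimage_cyl)
    next
      case 2
      then have "emeasure ?M (cyl w) = emeasure \<mu> (shift ` cyl [s])"
        using M[OF cyl_measurable[OF w]] s shift_image_cell_measurable[OF s, THEN sets.sets_into_space]
        by (simp add: tv case_nat_vimage_cyl space_\<mu> Int_absorb1)
      also have "\<dots> = ennreal R"
        using emeasure_shift_image_cell[OF s mass] R(2) by simp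
      finally show ?thesis
        using N[OF cyl_measurable[OF w]] 2 s cell by (simp add: tv mass)
    next
      case 3
      have S: "u \<in> S" "set v' \<subseteq> S"
        using tv 3 by auto
      have "cyl w \<subseteq> cyl [s]"
        using 3 by (auto simp: tv mem_cyl_Cons cylinder_def)
      then have N': "emeasure ?N (cyl w) = ?c * emeasure \<mu> (cyl w)"
        using N[OF cyl_measurable[OF w]] by (simp add: Int_absorb1)
      have M': "emeasure ?M (cyl w) = emeasure \<mu> (cyl (u # v') \<inter> shift ` cyl [s])"
        using M[OF cyl_measurable[OF w]] s 3 by (simp add: tv case_nat_vimage_cyl)
      show ?thesis
      proof (cases "A s u = 1")
        case True
        then have "?c * emeasure \<mu> (cyl w) = emeasure \<mu> (cyl (u # v'))"
          using 3 s S R step_scaling[OF s S(1) True S(2) R(1)] by (simp add: tv formula)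
        then show ?thesis
          using True s M' N' by (simp add: cyl_Int_shift_image_cell)
      next
        case False
        then show ?thesis
          using s 3 M' N' by (simp add: tv cyl_Int_shift_image_cell cyl_inadmissible)
      qed
    qed
  qed
  have "?M = ?N"
  proof (rule measure_eqI_cylinders)
    show "emeasure ?M (cyl [t]) \<noteq> \<infinity>" if "t \<in> S" for t
    proof -
      have "emeasure ?M (cyl [t]) = ?c * emeasure \<mu> (cyl [s] \<inter> cyl [t])"
        using eq[of "[t]"] N[of "cyl [t]"] that by simp
      also have "\<dots> \<le> ?c * emeasure \<mu> (cyl [s])"
        using emeasure_mono[of "cyl [s] \<inter> cyl [t]" "cyl [s]" \<mu>] s by (simp add: mult_left_mono)
      also have "\<dots> = ennreal R"
        by (simp only: mass[OF s] cell)
      finally show ?thesis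
        by (auto simp: top_unique)
    qed
  qed (use eq in \<open>simp_all add: sets_\<mu>\<close>)
  moreover have "emeasure ?M B = emeasure \<mu> (shift ` B)"
    using M[OF B(1)] shift_image[OF s B(2)] by simp
  moreover have "emeasure ?N B = ?c * emeasure \<mu> B"
    using N[OF B(1)] B(2) by (simp add: Int_absorb1)
  ultimately show ?thesis
    by simp
qed

lemma alpha_deriv_measure_exists:
  assumes finite: "\<forall>s\<in>S. Pi_sum S A \<pi> s < \<infinity>"
  shows "\<exists>\<mu>. alpha_deriv_measure S A \<pi> \<mu>"
proof -
  obtain \<mu> where \<mu>: "space \<mu> = X" "sets \<mu> = sigma_sets X cylinders"
    and formula: "\<And>w. w \<noteq> [] \<Longrightarrow> set w \<subseteq> S \<Longrightarrow>
      emeasure \<mu> (cyl w) = ennreal (\<pi> (w ! 0)) * ennreal (path_weight p w)"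
  proof (rule exists_markov_measure[OF stochastic_transition_prob[OF finite], where q = \<pi>])
    show "p s t = 0" if "s \<in> S" "t \<in> S" "A s t \<noteq> 1" for s t
      using that by (rule transition_prob_supported)
  qed (rule that)
  have mass: "\<And>s. s \<in> S \<Longrightarrow> emeasure \<mu> (cyl [s]) = ennreal (\<pi> s)"
    by (simp add: formula)
  then have M_alpha: "\<mu> \<in> M_alpha S A"
    by (simp add: M_alpha_iff \<mu>)
  have "\<exists>c. \<forall>B\<in>sets \<mu>. B \<subseteq> cyl [s] \<longrightarrow> emeasure \<mu> (shift ` B) = c * emeasure \<mu> B"
    if s: "s \<in> S" for s
  proof -
    obtain R where "0 < R" "Pi_sum S A \<pi> s = ennreal R"
      using finite s by (metis Pi_sum_real)
    then show ?thesis
      using scaling_if_markov[OF M_alpha formula s] by blast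
  qed
  then show ?thesis
    using mass M_alpha by (auto simp: alpha_deriv_measure_iff)
qed

end

theorem proposition3p0:
  fixes S :: "'a set" and A :: "'a \<Rightarrow> 'a \<Rightarrow> real" and \<pi> :: "'a \<Rightarrow> real"
  assumes "mixing_tms S A"
    and "\<And>s. s \<in> S \<Longrightarrow> \<pi> s > 0"
  shows "((\<exists>\<mu>. alpha_deriv_measure S A \<pi> \<mu>) \<longleftrightarrow> (\<forall>s\<in>S. Pi_sum S A \<pi> s < \<infinity>))
    \<and> ((\<forall>s\<in>S. Pi_sum S A \<pi> s < \<infinity>) \<longrightarrow>
         (\<exists>!\<mu>. alpha_deriv_measure S A \<pi> \<mu>)
         \<and> (\<forall>\<mu>. alpha_deriv_measure S A \<pi> \<mu> \<longrightarrow> markov_measure S A \<mu>))"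
proof -
  interpret weighted_markov_shift S A \<pi>
    using assms by unfold_locales (auto simp: mixing_tms_def)
  have "Pi_sum S A \<pi> s < \<infinity>" if "alpha_deriv_measure S A \<pi> \<mu>" "s \<in> S" for \<mu> s
    using scaling_factor[OF that] by (metis ennreal_less_top infinity_ennreal_def)
  then show ?thesis
    using alpha_deriv_measure_exists alpha_deriv_measure_unique markov_alpha_deriv_measure by blast
qed

end
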